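(* Let $u\in\Omega\neq\emptyset$, $c_u\geq\lVert x_0-u\rVert^2$, $L\geq\mathrm{diam}\{x_n\mid n\in\mathbb{N}\}$ ($L\in\mathbb{R}$), and let $M>0$ with $M\geq\lVert\xi_n\rVert$ for all $n\in\mathbb{N}$. Let $\lambda_n\in[a,b]\subseteq(0,2/M^2)$ for all $n\in\mathbb{N}$. Then for all $k\in\mathbb{N}$ and all $g:\mathbb{N}\to\mathbb{N}$: \[ \exists n\leq\Phi_3(k,g,c_u)\ \forall i\in[n;n+g(n)]\ \left(\lVert x_i-Tx_i\rVert<\frac1{k+1}\right), \] where \[ \Phi_3(k,g,c_u):=\Phi_1\left(\left\lceil(\eta(a,b,M,L))^4(k+1)^4\right\rceil-1,\,g',\,c_u\right)+1,\qquad g'(n):=g(n+1)+1, \] \[ \eta(a,b,M,L):=\frac{\sqrt{2MbL}}{\sqrt[4]{\alpha(a,b,M)}}+\frac{Mb}{\sqrt{\alpha(a,b,M)}}+1,\qquad \alpha(a,b,M):=-a(M^2b-2), \] and for $h:\mathbb{N}\to\mathbb{N}$, \[ \Phi_1(k,h,c_u):=\tilde h^{(\lceil c_u(k+1)\rceil)}(0),\qquad \tilde h(n):=n+h(n), \] with $\tilde h^{(m)}(0)$ the $m$-th iterate of $\tilde h$ starting from $0$.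
   Context: Notation: $\mathbb{N}=\{0,1,2,\dots\}$, $[n;m]:=\{n,n+1,\dots,m\}$. $\mathbb{R}^N$ ($N\geq1$) carries the Euclidean inner product and norm; $\overline{B_r(x)}$ is the closed ball. Setting: $f:\mathbb{R}^N\times\mathbb{R}^N\to\mathbb{R}$ satisfies: $f(x,x)=0$ for all $x$; $f(\cdot,y)$ is continuous for every $y$; $f(x,\cdot)$ is convex for every $x$. $T:\mathbb{R}^N\to\mathbb{R}^N$ is firmly nonexpansive, i.e. $\lVert Tx-Ty\rVert^2\leq\langle x-y,Tx-Ty\rangle$ for all $x,y$, with nonempty fixed point set $\mathrm{Fix}(T)$. The sequences are generated by the following algorithm: $x_0\in\mathbb{R}^N$ is arbitrary, $\rho_0:=\lVert x_0\rVert$. Given $x_n$ and $\rho_n$, choose $\varepsilon_n\geq0$ and $\lambda_n>0$; take $y_n\in K_n:=\overline{B_{\rho_n+1}(0)}$ with $f(y_n,x_n)\geq0$ and $\max_{y\in K_n}f(y,x_n)\leq f(y_n,x_n)+\varepsilon_n$; choose any $\xi_n\in\partial f(y_n,\cdot)(x_n)$ (subdifferential of the convex function $f(y_n,\cdot)$ at $x_n$); set $x_{n+1}:=T(x_n-\lambda_nf(y_n,x_n)\xi_n)$ and $\rho_{n+1}:=\max\{\rho_n,\lVert x_{n+1}\rVert\}$. $\Omega_n:=\{u\in\mathrm{Fix}(T)\mid f(y_n,u)\leq0\}$ and $\Omega:=\bigcap_{n\in\mathbb{N}}\Omega_n$. *)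

theory Defs
  imports "HOL-Analysis.Analysis"
begin

definition firmly_nonexpansive :: "('a::real_inner \<Rightarrow> 'a) \<Rightarrow> bool" where
  "firmly_nonexpansive T \<longleftrightarrow>
     (\<forall>x y. (norm (T x - T y))\<^sup>2 \<le> (x - y) \<bullet> (T x - T y))"

definition Fix :: "('a \<Rightarrow> 'a) \<Rightarrow> 'a set" where
  "Fix T = {x. T x = x}"

definition subdifferential :: "('a::real_inner \<Rightarrow> real) \<Rightarrow> 'a \<Rightarrow> 'a set" where
  "subdifferential h x = {\<xi>. \<forall>z. h x + \<xi> \<bullet> (z - x) \<le> h z}"

definition equilibrium_bifunction :: "('a::real_normed_vector \<Rightarrow> 'a \<Rightarrow> real) \<Rightarrow> bool" where
  "equilibrium_bifunction f \<longleftrightarrow>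
     (\<forall>x. f x x = 0) \<and>
     (\<forall>y. continuous_on UNIV (\<lambda>x. f x y)) \<and>
     (\<forall>x. convex_on UNIV (f x))"

(* The choices made by the algorithm (eps, lam, y, xi) are parameters, so this predicate
   describes an arbitrary run. The supremum over the compact ball is attained, hence a
   maximum, whenever f is continuous in its first argument. *)
definition algorithm_run ::
  "('a::euclidean_space \<Rightarrow> 'a \<Rightarrow> real) \<Rightarrow> ('a \<Rightarrow> 'a) \<Rightarrow> (nat \<Rightarrow> real) \<Rightarrow> (nat \<Rightarrow> real) \<Rightarrow>
   (nat \<Rightarrow> 'a) \<Rightarrow> (nat \<Rightarrow> real) \<Rightarrow> (nat \<Rightarrow> 'a) \<Rightarrow> (nat \<Rightarrow> 'a) \<Rightarrow> bool" where
  "algorithm_run f T eps lam x \<rho> y \<xi> \<longleftrightarrow>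
     \<rho> 0 = norm (x 0) \<and>
     (\<forall>n. eps n \<ge> 0 \<and>
          lam n > 0 \<and>
          y n \<in> cball 0 (\<rho> n + 1) \<and>
          f (y n) (x n) \<ge> 0 \<and>
          (SUP z\<in>cball 0 (\<rho> n + 1). f z (x n)) \<le> f (y n) (x n) + eps n \<and>
          \<xi> n \<in> subdifferential (f (y n)) (x n) \<and>
          x (Suc n) = T (x n - (lam n * f (y n) (x n)) *\<^sub>R \<xi> n) \<and>
          \<rho> (Suc n) = max (\<rho> n) (norm (x (Suc n))))"

definition Omega_n ::
  "('a \<Rightarrow> 'a \<Rightarrow> real) \<Rightarrow> ('a \<Rightarrow> 'a) \<Rightarrow> (nat \<Rightarrow> 'a) \<Rightarrow> nat \<Rightarrow> 'a set" where
  "Omega_n f T y n = {u \<in> Fix T. f (y n) u \<le> 0}"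

definition Omega ::
  "('a \<Rightarrow> 'a \<Rightarrow> real) \<Rightarrow> ('a \<Rightarrow> 'a) \<Rightarrow> (nat \<Rightarrow> 'a) \<Rightarrow> 'a set" where
  "Omega f T y = (\<Inter>n. Omega_n f T y n)"

definition alpha :: "real \<Rightarrow> real \<Rightarrow> real \<Rightarrow> real" where
  "alpha a b M = - a * (M\<^sup>2 * b - 2)"

definition eta :: "real \<Rightarrow> real \<Rightarrow> real \<Rightarrow> real \<Rightarrow> real" where
  "eta a b M L =
     sqrt (2 * M * b * L) / root 4 (alpha a b M) + M * b / sqrt (alpha a b M) + 1"

definition Phi1 :: "nat \<Rightarrow> (nat \<Rightarrow> nat) \<Rightarrow> real \<Rightarrow> nat" where
  "Phi1 k h c = ((\<lambda>n. n + h n) ^^ nat \<lceil>c * (real k + 1)\<rceil>) 0"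

(* In the intended range of parameters eta a b M L \<ge> 1, so neither nat nor the natural
   subtraction truncates. *)
definition Phi3 ::
  "real \<Rightarrow> real \<Rightarrow> real \<Rightarrow> real \<Rightarrow> nat \<Rightarrow> (nat \<Rightarrow> nat) \<Rightarrow> real \<Rightarrow> nat" where
  "Phi3 a b M L k g c =
     Phi1 (nat \<lceil>(eta a b M L) ^ 4 * (real k + 1) ^ 4\<rceil> - 1) (\<lambda>n. g (n + 1) + 1) c + 1"

end

theory Submission
  imports Defs
begin

text \<open>
  Both halves of an iteration decrease the distance to the solution \<open>u\<close>. The subgradient step
  from \<open>x n\<close> to \<open>z n\<close> moves no further from \<open>u\<close>, because \<open>f (y n) u \<le> 0 \<le> f (y n) (x n)\<close> and
  the step sizes stay below \<open>2 / M\<^sup>2\<close> (lemma \<open>norm_subgradient_step_le\<close>). The step from \<open>z n\<close> to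
  \<open>x (Suc n) = T (z n)\<close> gains the full square of its length, because \<open>T\<close> is firmly nonexpansive
  (lemma \<open>firmly_nonexpansive_fixed_point\<close>). Hence
  \<open>(norm (z n - x (Suc n)))\<^sup>2 \<le> (norm (x n - u))\<^sup>2 - (norm (x (Suc n) - u))\<^sup>2\<close>.

  The right-hand side is a decrement of a nonincreasing sequence in \<open>[0, c_u]\<close>. Such a sequence
  cannot drop by a fixed amount too often, so \<open>Phi1\<close> bounds the start of an interval of
  prescribed length over which the total drop is small (lemma \<open>Phi1_metastability\<close>); by
  monotonicity every single decrement within the interval is then small as well. Finally,
  \<open>T\<close> maps \<open>z n\<close> to \<open>x (Suc n)\<close> and is nonexpansive, so
  \<open>norm (x (Suc n) - T (x (Suc n))) \<le> norm (z n - x (Suc n))\<close>: the residual at index \<open>Suc n\<close> is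
  controlled by the decrement at \<open>n\<close>. This is the source of the index shifts in \<open>Phi3\<close>.

  As for the rate: the squared residual must fall below \<open>1 / (k + 1)\<^sup>2\<close>, while the tolerance for
  the decrements is at most \<open>1 / (eta ^ 4 * (k + 1) ^ 4)\<close>, so the bound \<open>eta \<ge> 1\<close> makes it
  small enough (lemma \<open>eta_ge_1\<close>).
\<close>

lemma firmly_nonexpansive_imp_nonexpansive:
  assumes "firmly_nonexpansive T"
  shows "norm (T x - T y) \<le> norm (x - y)"
proof -
  have "norm (T x - T y) * norm (T x - T y) \<le> (x - y) \<bullet> (T x - T y)"
    using assms by (auto simp: firmly_nonexpansive_def power2_eq_square)
  also have "\<dots> \<le> norm (x - y) * norm (T x - T y)"
    by (rule norm_cauchy_schwarz)
  finally show ?thesis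
    by (cases "norm (T x - T y) = 0") (auto simp: mult_le_cancel_right)
qed

text \<open>
  At a fixed point \<open>u\<close>, firm nonexpansiveness says that the angle at \<open>T z\<close> in the triangle
  \<open>z\<close>, \<open>T z\<close>, \<open>u\<close> is at least a right angle; the law of cosines then gives the inequality.
\<close>

lemma firmly_nonexpansive_fixed_point:
  assumes "firmly_nonexpansive T" "u \<in> Fix T"
  shows "(norm (T z - u))\<^sup>2 + (norm (z - T z))\<^sup>2 \<le> (norm (z - u))\<^sup>2"
proof -
  have "(norm (T z - T u))\<^sup>2 \<le> (z - u) \<bullet> (T z - T u)"
    using assms(1) by (auto simp: firmly_nonexpansive_def)
  moreover have "T u = u"
    using assms(2) by (simp add: Fix_def)
  ultimately have "(norm (T z - u))\<^sup>2 \<le> (z - u) \<bullet> (T z - u)"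
    by simp
  then show ?thesis
    by (simp add: power2_norm_eq_inner inner_diff inner_commute algebra_simps)
qed

text \<open>
  With the step size proportional to \<open>h x\<close>, the subgradient inequality at \<open>u\<close> makes the linear
  term of the expanded square at most \<open>- 2 * l * (h x)\<^sup>2\<close>, while the quadratic term is at most
  \<open>l\<^sup>2 * M\<^sup>2 * (h x)\<^sup>2\<close>. The condition \<open>l * M\<^sup>2 \<le> 2\<close> is exactly what makes their sum nonpositive.
\<close>

lemma norm_subgradient_step_le:
  assumes xi: "\<xi> \<in> subdifferential h x" and M: "norm \<xi> \<le> M"
    and h: "h u \<le> 0" "0 \<le> h x" and l: "0 \<le> l" "l * M\<^sup>2 \<le> 2"
  shows "norm (x - (l * h x) *\<^sub>R \<xi> - u) \<le> norm (x - u)"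
proof -
  have "h x + \<xi> \<bullet> (u - x) \<le> h u"
    using xi by (simp add: subdifferential_def)
  then have "h x \<le> \<xi> \<bullet> (x - u)"
    using h by (simp add: inner_diff_right)
  then have lin: "(l * h x) * h x \<le> (l * h x) * (\<xi> \<bullet> (x - u))"
    using h l by (intro mult_left_mono) auto
  have "(norm \<xi>)\<^sup>2 \<le> M\<^sup>2"
    using M by (intro power_mono) auto
  then have "l * (norm \<xi>)\<^sup>2 \<le> 2"
    using l mult_left_mono[of "(norm \<xi>)\<^sup>2" "M\<^sup>2" l] by linarith
  then have quad: "(l * (h x)\<^sup>2) * (l * (norm \<xi>)\<^sup>2) \<le> (l * (h x)\<^sup>2) * 2"
    using l by (intro mult_left_mono) auto
  have "(norm (x - (l * h x) *\<^sub>R \<xi> - u))\<^sup>2 = (norm ((x - u) - (l * h x) *\<^sub>R \<xi>))\<^sup>2"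
    by (simp add: algebra_simps)
  also have "\<dots> = (norm (x - u))\<^sup>2 - 2 * ((l * h x) * (\<xi> \<bullet> (x - u)))
      + (l * (h x)\<^sup>2) * (l * (norm \<xi>)\<^sup>2)"
    unfolding power2_norm_eq_inner
    by (simp only: inner_diff_left inner_diff_right inner_scaleR_left inner_scaleR_right)
       (simp add: inner_commute power2_eq_square algebra_simps)
  also have "\<dots> \<le> (norm (x - u))\<^sup>2"
    using lin quad by (simp add: power2_eq_square algebra_simps)
  finally show ?thesis
    by (rule power2_le_imp_le) simp
qed

text \<open>
  Iterating \<open>\<lambda>n. n + h n\<close> from \<open>0\<close> yields consecutive intervals \<open>[n, n + h n]\<close>. If \<open>s\<close> dropped by
  at least \<open>1 / (K + 1)\<close> over each of the intervals starting at the iterates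
  \<open>0, \<dots>, \<lceil>c * (K + 1)\<rceil>\<close>, the total drop would exceed \<open>c\<close>.
\<close>

lemma Phi1_metastability:
  fixes s :: "nat \<Rightarrow> real"
  assumes nonneg: "\<And>n. 0 \<le> s n" and c: "s 0 \<le> c"
  shows "\<exists>n \<le> Phi1 K h c. s n - s (n + h n) < 1 / (real K + 1)"
proof (rule ccontr)
  assume none: "\<not> ?thesis"
  define m where "m = nat \<lceil>c * (real K + 1)\<rceil>"
  define p where "p j = ((\<lambda>n. n + h n) ^^ j) 0" for j
  have step: "p (Suc j) = p j + h (p j)" for j
    by (simp add: p_def)
  have "mono p"
    by (rule incseq_SucI) (simp add: step)
  then have "p j \<le> Phi1 K h c" if "j \<le> m" for j
    using that by (auto simp: Phi1_def p_def m_def mono_def)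
  then have drop: "1 / (real K + 1) \<le> s (p j) - s (p (Suc j))" if "j \<le> m" for j
    using none that unfolding step by (meson not_less)
  have total: "real j / (real K + 1) \<le> s 0 - s (p j)" if "j \<le> Suc m" for j
    using that
  proof (induction j)
    case 0
    then show ?case by (simp add: p_def)
  next
    case (Suc j)
    then show ?case using drop[of j] by (simp add: add_divide_distrib)
  qed
  have "c * (real K + 1) < real (Suc m)"
    unfolding m_def by (simp add: le_less_trans[OF real_nat_ceiling_ge])
  then have "c < real (Suc m) / (real K + 1)"
    by (simp add: pos_less_divide_eq)
  also have "\<dots> \<le> s 0 - s (p (Suc m))"
    by (rule total) simp
  finally show False
    using c nonneg[of "p (Suc m)"] by simp
qed

lemma eta_ge_1:
  assumes "0 < a" "0 \<le> b" "0 \<le> M" "0 \<le> L" "M\<^sup>2 * b < 2"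
  shows "1 \<le> eta a b M L"
proof -
  have "0 < alpha a b M"
    unfolding alpha_def using assms by (simp add: mult_pos_neg)
  then show ?thesis
    using assms by (simp add: eta_def)
qed

theorem proposition9:
  fixes f :: "real ^ 'N \<Rightarrow> real ^ 'N \<Rightarrow> real"
    and T :: "real ^ 'N \<Rightarrow> real ^ 'N"
    and eps lam \<rho> :: "nat \<Rightarrow> real"
    and x y \<xi> :: "nat \<Rightarrow> real ^ 'N"
    and u :: "real ^ 'N"
    and c_u L M a b :: real
    and k :: nat
    and g :: "nat \<Rightarrow> nat"
  assumes "equilibrium_bifunction f"
    and "firmly_nonexpansive T"
    and "Fix T \<noteq> {}"
    and "algorithm_run f T eps lam x \<rho> y \<xi>"
    and "u \<in> Omega f T y"
    and "c_u \<ge> (norm (x 0 - u))\<^sup>2"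
    and "L \<ge> diameter (range x)"
    and "M > 0"
    and "\<And>n. M \<ge> norm (\<xi> n)"
    and "\<And>n. lam n \<in> {a..b}"
    and "{a..b} \<subseteq> {0<..<2 / M\<^sup>2}"
  shows "\<exists>n \<le> Phi3 a b M L k g c_u. \<forall>i \<in> {n..n + g n}.
           norm (x i - T (x i)) < 1 / (real k + 1)"
proof -
  note run = assms(4)[unfolded algorithm_run_def]
  define z where "z n = x n - (lam n * f (y n) (x n)) *\<^sub>R \<xi> n" for n
  define s where "s n = (norm (x n - u))\<^sup>2" for n
  have xSuc: "x (Suc n) = T (z n)" for n
    using run by (simp add: z_def)
  have "a \<le> b"
    using assms(10)[of 0] by simp
  then have ab: "0 < a" "b < 2 / M\<^sup>2"
    using assms(11) by (auto simp: subset_iff)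
  have lamM: "lam n * M\<^sup>2 \<le> 2" for n
  proof -
    have "lam n \<le> 2 / M\<^sup>2"
      using assms(10)[of n] ab by simp
    then show ?thesis
      using \<open>M > 0\<close> by (simp add: pos_le_divide_eq)
  qed
  have u: "u \<in> Fix T" "f (y n) u \<le> 0" for n
    using assms(5) by (auto simp: Omega_def Omega_n_def)
  have decrement: "(norm (z n - x (Suc n)))\<^sup>2 \<le> s n - s (Suc n)" for n
  proof -
    have "norm (z n - u) \<le> norm (x n - u)"
      unfolding z_def
      using run u(2)[of n] lamM[of n] assms(9)[of n]
      by (intro norm_subgradient_step_le[where M = M and h = "f (y n)"]) (auto simp: less_imp_le)
    then have "(norm (z n - u))\<^sup>2 \<le> s n"
      unfolding s_def by (rule power_mono) simp
    moreover have "s (Suc n) + (norm (z n - x (Suc n)))\<^sup>2 \<le> (norm (z n - u))\<^sup>2"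
      unfolding s_def xSuc by (rule firmly_nonexpansive_fixed_point[OF assms(2) u(1)])
    ultimately show ?thesis by linarith
  qed
  have "decseq s"
  proof (rule decseq_SucI)
    show "s (Suc n) \<le> s n" for n
      using decrement[of n] zero_le_power2[of "norm (z n - x (Suc n))"] by linarith
  qed
  \<comment> \<open>Boundedness of the orbit makes its diameter a genuine supremum, hence nonnegative.\<close>
  have "norm (x n - u) \<le> norm (x 0 - u)" for n
    using decseqD[OF \<open>decseq s\<close>, of 0 n] unfolding s_def by (rule power2_le_imp_le) simp_all
  then have "bounded (range x)"
    unfolding bounded_def
    by (auto simp: dist_norm norm_minus_commute intro!: exI[of _ u] exI[of _ "norm (x 0 - u)"])
  then have "0 \<le> L"
    using diameter_ge_0[of "range x"] assms(7) by linarith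
  then have eta: "1 \<le> eta a b M L"
    using ab \<open>a \<le> b\<close> \<open>M > 0\<close> by (intro eta_ge_1) (auto simp: pos_less_divide_eq mult.commute)

  define K where "K = nat \<lceil>eta a b M L ^ 4 * (real k + 1) ^ 4\<rceil> - 1"
  have K: "(real k + 1)\<^sup>2 \<le> real K + 1"
  proof -
    have "(real k + 1)\<^sup>2 \<le> (real k + 1) ^ 4"
      by (rule power_increasing) auto
    also have "\<dots> \<le> eta a b M L ^ 4 * (real k + 1) ^ 4"
      using eta by (simp add: mult_le_cancel_right1 one_le_power)
    also have "\<dots> \<le> real (nat \<lceil>eta a b M L ^ 4 * (real k + 1) ^ 4\<rceil>)"
      by (rule real_nat_ceiling_ge)
    also have "\<dots> \<le> real K + 1"
      unfolding K_def by linarith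
    finally show ?thesis .
  qed
  obtain n where n: "n \<le> Phi1 K (\<lambda>n. g (n + 1) + 1) c_u"
    and small: "s n - s (n + (g (n + 1) + 1)) < 1 / (real K + 1)"
    using Phi1_metastability[of s c_u K "\<lambda>n. g (n + 1) + 1"] assms(6) by (auto simp: s_def)
  have "norm (x (Suc j) - T (x (Suc j))) < 1 / (real k + 1)"
    if "n \<le> j" "j \<le> n + g (n + 1)" for j
  proof -
    have "(norm (z j - x (Suc j)))\<^sup>2 \<le> s j - s (Suc j)"
      by (rule decrement)
    also have "\<dots> \<le> s n - s (n + (g (n + 1) + 1))"
      using that by (intro diff_mono decseqD[OF \<open>decseq s\<close>]) auto
    also have "\<dots> < 1 / (real K + 1)"
      by (rule small)
    also have "\<dots> \<le> (1 / (real k + 1))\<^sup>2"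
      using K by (simp add: power_divide frac_le)
    finally have "norm (z j - x (Suc j)) < 1 / (real k + 1)"
      by (rule power2_less_imp_less) simp
    moreover have "norm (x (Suc j) - T (x (Suc j))) \<le> norm (z j - x (Suc j))"
      using firmly_nonexpansive_imp_nonexpansive[OF assms(2), of "z j" "x (Suc j)"]
      by (simp add: xSuc)
    ultimately show ?thesis by linarith
  qed
  then have "norm (x i - T (x i)) < 1 / (real k + 1)"
    if "i \<in> {n + 1..n + 1 + g (n + 1)}" for i
    using that by (cases i) auto
  moreover have "n + 1 \<le> Phi3 a b M L k g c_u"
    using n by (simp add: Phi3_def K_def)
  ultimately show ?thesis by blast
qed

end
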